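(* Let $r \geq 1$ and let $G$ be a finite Abelian group of rank $r$ and exponent $n$. Then $$\mathsf{t}(G) \leq c_r\sum_{d \mid n} \left(\frac{d}{P^{+}(d)^{\nu_{P^+(d)}(d)}}-1\right) + c_r\left(n-1\right) + 1,$$ where the sum runs over all positive divisors $d$ of $n$.
   Context: $G$ is written additively; writing $G \simeq C_{n_1}\oplus\cdots\oplus C_{n_r}$ with $1<n_1\mid\cdots\mid n_r$, $r$ is the rank and $n_r=\exp(G)$ the exponent. A sequence over $G$ is a finite unordered sequence $S=(g_1,\dots,g_\ell)$ of elements of $G$ (repetitions allowed, i.e. a multiset); $|S|=\ell$ is its length, $\sigma(S)=\sum g_i$ its sum, a subsequence is a sub-multiset, and $S$ is zero-sum if $\sigma(S)=0$. The cross number is $\mathsf{k}(S)=\sum_{i=1}^{\ell} 1/\mathrm{ord}(g_i)$. A tiny zero-sum subsequence of $S$ is a non-empty zero-sum subsequence $S'$ with $\mathsf{k}(S')\leq 1$. $\mathsf{t}(G)$ is the smallest positive integer $t$ such that every sequence over $G$ of length at least $t$ contains a tiny zero-sum subsequence. $\eta(G)$ is the smallest positive integer $t$ such that every sequence over $G$ of length at least $t$ contains a non-empty zero-sum subsequence of length at most $\exp(G)$. For $r\geq1$, $c_r$ denotes the smallest real constant $c>0$ such that $\eta(C_m^r)\leq c(m-1)+1$ for every integer $m\geq1$ (it exists by a theorem of Alon and Dubiner). For an integer $d\geq1$, $P^+(d)$ is the largest prime divisor of $d$, with $P^+(1)=1$, and $\nu_p(d)$ is the $p$-adic valuation; the summand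 for $d=1$ is taken to be $0$ (i.e. $P^+(1)^{\nu_{P^+(1)}(1)}=1$). *)

theory Defs
  imports
    Complex_Main
    "HOL-Library.Multiset"
    "HOL-Computational_Algebra.Primes"
    "HOL-Algebra.Multiplicative_Group"
    "HOL-Algebra.Elementary_Groups"
    "HOL-Algebra.Product_Groups"
begin

text \<open>
  Abelian groups are \<open>comm_group\<close>s of HOL-Algebra, hence written multiplicatively: the sum of a
  sequence becomes a product and "zero-sum" means that this product is the unit element.
  Unordered sequences are multisets over the carrier.
\<close>

definition seq_over :: "('a, 'b) monoid_scheme \<Rightarrow> 'a multiset \<Rightarrow> bool" where
  "seq_over G S \<longleftrightarrow> set_mset S \<subseteq> carrier G"

definition seq_sum :: "('a, 'b) monoid_scheme \<Rightarrow> 'a multiset \<Rightarrow> 'a" where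
  "seq_sum G S = finprod G (\<lambda>g. g [^]\<^bsub>G\<^esub> count S g) (set_mset S)"

definition zero_sum :: "('a, 'b) monoid_scheme \<Rightarrow> 'a multiset \<Rightarrow> bool" where
  "zero_sum G S \<longleftrightarrow> seq_sum G S = \<one>\<^bsub>G\<^esub>"

definition cross_number :: "('a, 'b) monoid_scheme \<Rightarrow> 'a multiset \<Rightarrow> real" where
  "cross_number G S = (\<Sum>g\<in>#S. 1 / real (group.ord G g))"

definition tiny_zero_sum_subseq :: "('a, 'b) monoid_scheme \<Rightarrow> 'a multiset \<Rightarrow> 'a multiset \<Rightarrow> bool" where
  "tiny_zero_sum_subseq G S T \<longleftrightarrow>
     T \<subseteq># S \<and> T \<noteq> {#} \<and> zero_sum G T \<and> cross_number G T \<le> 1"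

definition tiny_const :: "('a, 'b) monoid_scheme \<Rightarrow> nat" where
  "tiny_const G = (LEAST t. 0 < t \<and>
     (\<forall>S. seq_over G S \<and> t \<le> size S \<longrightarrow> (\<exists>T. tiny_zero_sum_subseq G S T)))"

definition group_exponent :: "('a, 'b) monoid_scheme \<Rightarrow> nat" where
  "group_exponent G = (LEAST n. 0 < n \<and> (\<forall>x\<in>carrier G. x [^]\<^bsub>G\<^esub> n = \<one>\<^bsub>G\<^esub>))"

definition eta_const :: "('a, 'b) monoid_scheme \<Rightarrow> nat" where
  "eta_const G = (LEAST t. 0 < t \<and>
     (\<forall>S. seq_over G S \<and> t \<le> size S \<longrightarrow>
        (\<exists>T. T \<subseteq># S \<and> T \<noteq> {#} \<and> zero_sum G T \<and> size T \<le> group_exponent G)))"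

definition invariant_factors :: "('a, 'b) monoid_scheme \<Rightarrow> nat list \<Rightarrow> bool" where
  "invariant_factors G ns \<longleftrightarrow>
     (\<forall>n\<in>set ns. 1 < n) \<and> sorted_wrt (dvd) ns \<and>
     G \<cong> product_group {..<length ns} (\<lambda>i. integer_mod_group (ns ! i))"

definition has_rank :: "('a, 'b) monoid_scheme \<Rightarrow> nat \<Rightarrow> bool" where
  "has_rank G r \<longleftrightarrow> (\<exists>ns. invariant_factors G ns \<and> length ns = r)"

text \<open>The homocyclic group \<open>C_m^r\<close>; only used for \<open>m \<ge> 1\<close>, since \<open>integer_mod_group 0\<close> is infinite.\<close>

definition cyclic_power :: "nat \<Rightarrow> nat \<Rightarrow> (nat \<Rightarrow> int) monoid" where
  "cyclic_power m r = product_group {..<r} (\<lambda>_. integer_mod_group m)"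

definition eta_linear_bound :: "nat \<Rightarrow> real \<Rightarrow> bool" where
  "eta_linear_bound r c \<longleftrightarrow>
     0 < c \<and> (\<forall>m\<ge>1. real (eta_const (cyclic_power m r)) \<le> c * (real m - 1) + 1)"

text \<open>
  \<open>is_eta_slope r c\<close> says that \<open>c\<close> is the constant \<open>c_r\<close>. It determines \<open>c\<close> uniquely; that such a
  \<open>c\<close> exists for every \<open>r \<ge> 1\<close> is a theorem of Alon and Dubiner.
\<close>

definition is_eta_slope :: "nat \<Rightarrow> real \<Rightarrow> bool" where
  "is_eta_slope r c \<longleftrightarrow>
     eta_linear_bound r c \<and> (\<forall>c'. eta_linear_bound r c' \<longrightarrow> c \<le> c')"

definition largest_prime_divisor :: "nat \<Rightarrow> nat" where
  "largest_prime_divisor d = (if d = 1 then 1 else Max {p. prime p \<and> p dvd d})"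

end

theory Submission
  imports Defs
begin

text \<open>
  If \<open>m\<close> divides \<open>e\<close>, then among more than \<open>c\<^sub>r (m - 1)\<close> elements of \<open>G\<close> killed by \<open>e\<close> there are at
  most \<open>m\<close> (and at least one) whose sum is killed by \<open>e / m\<close>, because the \<open>e\<close>-torsion modulo the
  \<open>e / m\<close>-torsion embeds into \<open>C_m^r\<close>.

  For \<open>d\<close> dividing \<open>n\<close> put \<open>p = P\<^sup>+(d)\<close>, \<open>q = p ^ \<nu>\<^sub>p(d)\<close> and \<open>d' = d / q\<close>. Merging elements of
  order \<open>d\<close> in this way with \<open>m = d'\<close> leaves at most \<open>c\<^sub>r (d' - 1)\<close> of them unused, and gives blocks of
  length at most \<open>d'\<close> and cross number at most \<open>d' / d = 1 / q\<close> whose sum is killed by \<open>q\<close>. All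
  primes dividing \<open>d'\<close> are below \<open>p\<close>, so \<open>d'\<close> is at most the product \<open>u\<^sub>p\<close> of the maximal powers
  \<open>l ^ \<nu>\<^sub>l(n)\<close> over the primes \<open>l < p\<close>. The sum of \<open>u\<^sub>p (p ^ \<nu>\<^sub>p(n) - 1)\<close> over the primes \<open>p\<close>
  telescopes to \<open>n - 1\<close>. As more than \<open>c\<^sub>r (n - 1)\<close> elements lie in blocks, for some \<open>p\<close> there are
  more than \<open>c\<^sub>r (p ^ \<nu>\<^sub>p(n) - 1)\<close> blocks with sum killed by a power of \<open>p\<close>, and repeated merging with
  \<open>m = p\<close> turns these into a tiny zero-sum subsequence.
\<close>

section \<open>Multisets\<close>

text \<open>Pulls a zero-sum subsequence found among images in \<open>cyclic_power m r\<close> back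
  to the original entries; \<open>f\<close> may fail to be injective.\<close>

lemma subseteq_image_msetE:
  assumes "T \<subseteq># image_mset f M"
  obtains N where "N \<subseteq># M" "image_mset f N = T"
proof -
  have "\<exists>N. N \<subseteq># M \<and> image_mset f N = T"
    using assms
  proof (induction M arbitrary: T)
    case empty
    then show ?case by auto
  next
    case (add x M)
    show ?case
    proof (cases "f x \<in># T")
      case True
      then obtain T' where T: "T = add_mset (f x) T'"
        by (meson multi_member_split)
      with add obtain N where "N \<subseteq># M" "image_mset f N = T'"
        by auto
      with T show ?thesis
        by (intro exI[of _ "add_mset x N"]) auto
    next
      case False
      with add.prems have "T \<subseteq># image_mset f M"
        by (force simp: subseteq_mset_def not_in_iff split: if_splits)
      with add.IH obtain N where "N \<subseteq># M" "image_mset f N = T"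
        by blast
      then show ?thesis
        by (intro exI[of _ N]) (auto simp: subseteq_mset_def le_SucI)
    qed
  qed
  with that show ?thesis by blast
qed

text \<open>Removing one nonempty block after another shrinks \<open>M\<close>, and the process can
  only stop once at most \<open>b\<close> entries are left.\<close>

lemma greedy_extraction:
  fixes b :: real
  assumes "\<And>N. N \<subseteq># M \<Longrightarrow> b < size N \<Longrightarrow> \<exists>B. B \<subseteq># N \<and> B \<noteq> {#} \<and> Q B"
  shows "\<exists>F. (\<forall>B\<in>#F. B \<noteq> {#} \<and> Q B) \<and> \<Sum>\<^sub># F \<subseteq># M \<and> real (size M) \<le> size (\<Sum>\<^sub># F) + b"
  using assms
proof (induction "size M" arbitrary: M rule: less_induct)
  case less
  show ?case
  proof (cases "b < size M")
    case False
    then show ?thesis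
      by (intro exI[of _ "{#}"]) auto
  next
    case True
    then obtain B where B: "B \<subseteq># M" "B \<noteq> {#}" "Q B"
      using less.prems by blast
    then have size: "size (M - B) + size B = size M"
      by (metis size_union subset_mset.diff_add)
    moreover have "size B > 0"
      using B by (simp add: nonempty_has_size)
    ultimately have "size (M - B) < size M"
      by linarith
    moreover have "N \<subseteq># M" if "N \<subseteq># M - B" for N
      using that by (meson diff_subset_eq_self subset_mset.order_trans)
    ultimately obtain F where F: "\<forall>B\<in>#F. B \<noteq> {#} \<and> Q B" "\<Sum>\<^sub># F \<subseteq># M - B"
      "real (size (M - B)) \<le> size (\<Sum>\<^sub># F) + b"
      using less.hyps[of "M - B"] less.prems by blast
    have "\<Sum>\<^sub># (add_mset B F) \<subseteq># M"
      using F(2) subset_mset.le_diff_conv2[OF B(1)] by (simp add: add.commute)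
    moreover have "real (size M) \<le> size (\<Sum>\<^sub># (add_mset B F)) + b"
      using F(3) size by (simp del: size_mset_sum_mset_conv)
    ultimately show ?thesis
      using F(1) B by (intro exI[of _ "add_mset B F"]) (auto simp del: size_mset_sum_mset_conv)
  qed
qed

lemma mset_eq_sum_filter:
  assumes "finite A" "\<And>x. x \<in># S \<Longrightarrow> f x \<in> A"
  shows "S = (\<Sum>d\<in>A. filter_mset (\<lambda>x. f x = d) S)"
proof (rule multiset_eqI)
  fix x
  have "(\<Sum>d\<in>A. count (filter_mset (\<lambda>x. f x = d) S) x) = (\<Sum>d\<in>A. if f x = d then count S x else 0)"
    by (intro sum.cong) auto
  also have "\<dots> = count S x"
    using assms(1) assms(2)[of x] by (auto simp: sum.delta' simp flip: not_in_iff)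
  finally show "count S x = count (\<Sum>d\<in>A. filter_mset (\<lambda>x. f x = d) S) x"
    by (simp add: count_sum)
qed

lemma sum_subseteq_mset_mono:
  fixes f g :: "'a \<Rightarrow> 'b multiset"
  assumes "\<And>x. x \<in> A \<Longrightarrow> f x \<subseteq># g x"
  shows "(\<Sum>x\<in>A. f x) \<subseteq># (\<Sum>x\<in>A. g x)"
  using assms by (induction A rule: infinite_finite_induct) (auto intro: subset_mset.add_mono)

section \<open>Sums of sequences\<close>

lemma seq_over_simps [simp]:
  "seq_over G {#}"
  "seq_over G (add_mset x S) \<longleftrightarrow> x \<in> carrier G \<and> seq_over G S"
  "seq_over G (S + T) \<longleftrightarrow> seq_over G S \<and> seq_over G T"
  by (auto simp: seq_over_def)

context comm_group
begin

lemma seq_sum_empty [simp]: "seq_sum G {#} = \<one>"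
  by (simp add: seq_sum_def)

text \<open>Turns the product of powers over the support into a recursion, so that later facts
  follow by induction on multisets.\<close>

lemma seq_sum_add_mset [simp]:
  assumes "x \<in> carrier G" "seq_over G S"
  shows "seq_sum G (add_mset x S) = x \<otimes> seq_sum G S"
proof -
  define A where "A = set_mset S - {x}"
  have fin: "finite A" "x \<notin> A" and A: "A \<subseteq> carrier G"
    using assms by (auto simp: A_def seq_over_def)
  \<comment> \<open>If \<open>x\<close> does not occur in \<open>S\<close>, it contributes the
    factor \<open>x [^] 0\<close>, so both supports can be extended to
    \<open>insert x A\<close>.\<close>
  have split: "seq_sum G T = x [^] count T x \<otimes> finprod G (\<lambda>g. g [^] count T g) A"
    if "T = S \<or> T = add_mset x S" for T
  proof -
    have "seq_sum G T = finprod G (\<lambda>g. g [^] count T g) (insert x A)"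
      unfolding seq_sum_def using that A assms
      by (intro finprod_mono_neutral_cong_left) (auto simp: A_def not_in_iff)
    also have "\<dots> = x [^] count T x \<otimes> finprod G (\<lambda>g. g [^] count T g) A"
      using fin A assms by (intro finprod_insert) auto
    finally show ?thesis .
  qed
  have "finprod G (\<lambda>g. g [^] count (add_mset x S) g) A = finprod G (\<lambda>g. g [^] count S g) A"
    using A by (intro finprod_cong') (auto simp: A_def)
  moreover have "finprod G (\<lambda>g. g [^] count S g) A \<in> carrier G"
    using A by (intro finprod_closed) auto
  ultimately show ?thesis
    using split[of S] split[of "add_mset x S"] assms
    by (simp add: m_ac)
qed

lemma seq_sum_closed [simp]: "seq_over G S \<Longrightarrow> seq_sum G S \<in> carrier G"
  by (induction S) auto

lemma seq_sum_union [simp]: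
  "seq_over G S \<Longrightarrow> seq_over G T \<Longrightarrow> seq_sum G (S + T) = seq_sum G S \<otimes> seq_sum G T"
  by (induction S) (auto simp: m_assoc)

lemma seq_sum_replicate_mset: "x \<in> carrier G \<Longrightarrow> seq_sum G (replicate_mset k x) = x [^] k"
  by (induction k) (auto simp: seq_over_def m_comm)

text \<open>Serves merging in stages, where the entries to be merged are blocks represented by their
  sums.\<close>

lemma seq_sum_Union:
  assumes "\<And>x. x \<in># N \<Longrightarrow> seq_over G (g x)"
  shows "seq_over G (\<Sum>x\<in>#N. g x)"
    and "seq_sum G (\<Sum>x\<in>#N. g x) = seq_sum G (image_mset (\<lambda>x. seq_sum G (g x)) N)"
proof -
  have "seq_over G (\<Sum>x\<in>#N. g x) \<and> seq_over G (image_mset (\<lambda>x. seq_sum G (g x)) N) \<and>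
      seq_sum G (\<Sum>x\<in>#N. g x) = seq_sum G (image_mset (\<lambda>x. seq_sum G (g x)) N)"
    using assms by (induction N) auto
  then show "seq_over G (\<Sum>x\<in>#N. g x)"
    and "seq_sum G (\<Sum>x\<in>#N. g x) = seq_sum G (image_mset (\<lambda>x. seq_sum G (g x)) N)"
    by auto
qed

text \<open>The group order is one admissible exponent, so the minimum is attained.\<close>

lemma group_exponent_finite:
  assumes "finite (carrier G)"
  shows "0 < group_exponent G" "\<And>x. x \<in> carrier G \<Longrightarrow> x [^] group_exponent G = \<one>"
proof -
  have "0 < order G \<and> (\<forall>x\<in>carrier G. x [^] order G = \<one>)"
    using assms order_gt_0_iff_finite pow_order_eq_1 by blast
  then have "0 < group_exponent G \<and> (\<forall>x\<in>carrier G. x [^] group_exponent G = \<one>)"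
    unfolding group_exponent_def by (rule LeastI)
  then show "0 < group_exponent G" "\<And>x. x \<in> carrier G \<Longrightarrow> x [^] group_exponent G = \<one>"
    by auto
qed

text \<open>
  By the pigeonhole principle, a sequence of length \<open>|G| exp(G)\<close> repeats some element
  \<open>exp(G)\<close> times, so the minimum in the definition of \<open>\<eta>(G)\<close> is taken over a nonempty set.
\<close>

lemma eta_const_finite:
  assumes fin: "finite (carrier G)" and "seq_over G S" "eta_const G \<le> size S"
  shows "\<exists>T. T \<subseteq># S \<and> T \<noteq> {#} \<and> zero_sum G T \<and> size T \<le> group_exponent G"
proof -
  let ?n = "group_exponent G"
  let ?P = "\<lambda>t. 0 < t \<and> (\<forall>S. seq_over G S \<and> t \<le> size S \<longrightarrow>
        (\<exists>T. T \<subseteq># S \<and> T \<noteq> {#} \<and> zero_sum G T \<and> size T \<le> ?n))"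
  note n = group_exponent_finite[OF fin]
  have "?P (order G * ?n)"
  proof (intro conjI allI impI)
    show "0 < order G * ?n"
      using n fin order_gt_0_iff_finite by simp
    fix S assume S: "seq_over G S \<and> order G * ?n \<le> size S"
    have "\<exists>g\<in>carrier G. ?n \<le> count S g"
    proof (rule ccontr)
      assume "\<not> ?thesis"
      then have "(\<Sum>g\<in>carrier G. count S g) < (\<Sum>g\<in>carrier G. ?n)"
        using fin by (intro sum_strict_mono) (auto simp: not_le)
      moreover have "size S = (\<Sum>g\<in>carrier G. count S g)"
        unfolding size_multiset_overloaded_eq using S fin
        by (intro sum.mono_neutral_left) (auto simp: seq_over_def not_in_iff)
      ultimately show False
        using S by (simp add: order_def)
    qed
    then obtain g where g: "g \<in> carrier G" "?n \<le> count S g" by blast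
    then show "\<exists>T. T \<subseteq># S \<and> T \<noteq> {#} \<and> zero_sum G T \<and> size T \<le> ?n"
      using n by (intro exI[of _ "replicate_mset ?n g"])
        (auto simp: zero_sum_def seq_sum_replicate_mset count_le_replicate_mset_subset_eq
          simp flip: size_eq_0_iff_empty)
  qed
  then have "?P (eta_const G)"
    unfolding eta_const_def by (rule LeastI)
  with assms show ?thesis by blast
qed

end

section \<open>Products of cyclic groups\<close>

lemma comm_group_product_integer_mod_group:
  "comm_group (product_group I (\<lambda>i. integer_mod_group (k i)))"
  by (intro group.group_comm_groupI) (auto simp: add.commute)

lemma pow_product_integer_mod_group:
  assumes "x \<in> carrier (product_group I (\<lambda>i. integer_mod_group (k i)))" "i \<in> I"
  shows "(x [^]\<^bsub>product_group I (\<lambda>i. integer_mod_group (k i))\<^esub> (e::nat)) i = (int e * x i) mod int (k i)"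
  using assms
  by (induction e) (auto simp: algebra_simps mod_simps)

lemma cyclic_power_pow:
  assumes "x \<in> carrier (cyclic_power m r)"
  shows "x [^]\<^bsub>cyclic_power m r\<^esub> m = \<one>\<^bsub>cyclic_power m r\<^esub>"
proof
  interpret comm_group "cyclic_power m r"
    unfolding cyclic_power_def by (rule comm_group_product_integer_mod_group)
  fix i
  show "(x [^]\<^bsub>cyclic_power m r\<^esub> m) i = \<one>\<^bsub>cyclic_power m r\<^esub> i"
  proof (cases "i < r")
    case True
    then show ?thesis
      using assms pow_product_integer_mod_group[of x "{..<r}" "\<lambda>_. m" i m]
      by (simp add: cyclic_power_def)
  next
    case False
    \<comment> \<open>Outside the index set both functions take the value
      \<open>undefined\<close>.\<close>
    then show ?thesis
      using nat_pow_closed[OF assms, of m] one_closed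
      by (auto simp: cyclic_power_def PiE_def extensional_def)
  qed
qed

lemma finite_cyclic_power: "0 < m \<Longrightarrow> finite (carrier (cyclic_power m r))"
  by (auto simp: cyclic_power_def carrier_integer_mod_group intro!: finite_PiE)

text \<open>Since lengths are integers, \<open>size S > c * (m - 1)\<close> already forces
  \<open>size S\<close> to reach \<open>eta_const\<close>; the exponent is at most \<open>m\<close>,
  which bounds the length of \<open>T\<close>.\<close>

lemma eta_linear_boundD:
  assumes c: "eta_linear_bound r c" and m: "0 < m"
    and S: "seq_over (cyclic_power m r) S" "c * (real m - 1) < size S"
  shows "\<exists>T. T \<subseteq># S \<and> T \<noteq> {#} \<and> zero_sum (cyclic_power m r) T \<and> size T \<le> m"
proof -
  interpret comm_group "cyclic_power m r"
    unfolding cyclic_power_def by (rule comm_group_product_integer_mod_group)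
  have "group_exponent (cyclic_power m r) \<le> m"
    unfolding group_exponent_def using m cyclic_power_pow by (intro Least_le) auto
  moreover have "real (eta_const (cyclic_power m r)) \<le> c * (real m - 1) + 1"
    using c m by (simp add: eta_linear_bound_def)
  then have "eta_const (cyclic_power m r) \<le> size S"
    using S by linarith
  ultimately show ?thesis
    using eta_const_finite[OF finite_cyclic_power[OF m] S(1)] by (meson order_trans)
qed

text \<open>Reducing \<open>a + b\<close> modulo \<open>k\<close> changes
  \<open>e * (a + b) div k\<close> by a multiple of \<open>e\<close>, hence of \<open>m\<close>.
  This gives additivity of the torsion map in each coordinate.\<close>

lemma scaled_quotient_add_mod:
  fixes a b e k m :: int
  assumes "0 < k" "k dvd e * a" "k dvd e * b" "m dvd e"
  shows "(e * ((a + b) mod k) div k) mod m = ((e * a div k) mod m + (e * b div k) mod m) mod m"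
proof -
  obtain u v w where u: "e * a = k * u" and v: "e * b = k * v" and w: "e = m * w"
    using assms by (auto elim!: dvdE)
  define q where "q = (a + b) div k"
  have "(a + b) mod k = a + b - k * q"
    by (simp add: q_def minus_mult_div_eq_mod)
  then have "e * ((a + b) mod k) = e * a + e * b - k * (e * q)"
    by (simp add: right_diff_distrib distrib_left mult.left_commute)
  then have "e * ((a + b) mod k) = k * (u + v - e * q)"
    using u v by (simp add: algebra_simps)
  then have "e * ((a + b) mod k) div k = u + v - m * (w * q)"
    using assms(1) w by (simp add: mult.assoc)
  moreover have "(u + v - m * (w * q)) mod m = (u + v) mod m"
    by (simp add: mod_diff_right_eq[symmetric])
  ultimately show ?thesis
    using u v assms(1) by (simp add: mod_add_eq)
qed

text \<open>Write \<open>m * e * a = k * u\<close> with \<open>m\<close> dividing \<open>u\<close>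
  and cancel \<open>m\<close>. This identifies the kernel of the torsion map, with \<open>e\<close>
  in the role of the quotient by \<open>m\<close>.\<close>

lemma scaled_quotient_mod_eq_0:
  fixes a e k m :: int
  assumes "0 < k" "0 < m" "k dvd m * e * a" "(m * e * a div k) mod m = 0"
  shows "k dvd e * a"
proof -
  obtain u where u: "m * e * a = k * u"
    using assms by (auto elim!: dvdE)
  with assms obtain v where "u = m * v"
    by (auto elim!: dvdE)
  with u have "m * (e * a) = m * (k * v)"
    by (simp add: algebra_simps)
  with assms(2) show ?thesis by simp
qed

section \<open>The largest prime divisor\<close>

lemma largest_prime_divisor_cases:
  assumes "0 < d"
  obtains "d = 1" "largest_prime_divisor d = 1"
  | "prime (largest_prime_divisor d)" "largest_prime_divisor d dvd d"
    "\<And>p. prime p \<Longrightarrow> p dvd d \<Longrightarrow> p \<le> largest_prime_divisor d"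
proof (cases "d = 1")
  case True
  with that(1) show ?thesis by (simp add: largest_prime_divisor_def)
next
  case False
  let ?A = "{p. prime p \<and> p dvd d}"
  have fin: "finite ?A"
    using assms by (auto intro: finite_subset[OF _ finite_divisors_nat])
  moreover have "?A \<noteq> {}"
    using prime_factor_nat[OF False] by blast
  ultimately have "Max ?A \<in> ?A" by (rule Max_in)
  moreover have "p \<le> Max ?A" if "p \<in> ?A" for p
    using fin that by (rule Max_ge)
  ultimately show ?thesis
    using that(2) False by (simp add: largest_prime_divisor_def)
qed

text \<open>The value 1 at non-primes allows products over all \<open>j < k\<close> in place of
  products over primes.\<close>

definition prime_part :: "nat \<Rightarrow> nat \<Rightarrow> nat" where
  "prime_part n p = (if prime p then p ^ multiplicity p n else 1)"

lemma prod_prime_part: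
  assumes "0 < n"
  shows "(\<Prod>j<Suc n. prime_part n j) = n"
proof -
  have "prime_factors n \<subseteq> {..<Suc n}"
    using assms by (auto simp: prime_factors_dvd dest: dvd_imp_le)
  then have "(\<Prod>j\<in>prime_factors n. prime_part n j) = (\<Prod>j<Suc n. prime_part n j)"
    using assms by (intro prod.mono_neutral_left)
      (auto simp: prime_part_def prime_factors_dvd not_dvd_imp_multiplicity_0)
  moreover have "(\<Prod>j\<in>prime_factors n. prime_part n j) = (\<Prod>j\<in>prime_factors n. j ^ multiplicity j n)"
    by (intro prod.cong) (auto simp: prime_part_def)
  ultimately show ?thesis
    using prime_factorization_nat[OF assms] by simp
qed

text \<open>Each summand is the difference of two consecutive partial products.\<close>

lemma sum_prod_telescope:
  fixes f :: "nat \<Rightarrow> 'a::comm_ring_1"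
  shows "(\<Sum>k<N. (\<Prod>j<k. f j) * (f k - 1)) = (\<Prod>j<N. f j) - 1"
  by (induction N) (simp_all add: algebra_simps)

definition cofactor :: "nat \<Rightarrow> nat" where
  "cofactor d = d div largest_prime_divisor d ^ multiplicity (largest_prime_divisor d) d"

lemma cofactor_mult:
  "d = largest_prime_divisor d ^ multiplicity (largest_prime_divisor d) d * cofactor d"
  by (simp add: cofactor_def multiplicity_dvd)

text \<open>All primes dividing the cofactor of \<open>d\<close> are smaller than the largest prime divisor of \<open>d\<close>.\<close>

lemma cofactor_le:
  assumes "0 < n" "d dvd n"
  shows "cofactor d \<le> (\<Prod>j<largest_prime_divisor d. prime_part n j)"
proof -
  have d: "0 < d" using assms by (auto intro: Nat.gr0I)
  have pos: "0 < prime_part n j" for j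
    by (auto simp: prime_part_def prime_gt_0_nat)
  let ?p = "largest_prime_divisor d"
  show ?thesis
    using d
  proof (cases rule: largest_prime_divisor_cases)
    case 1
    then show ?thesis using prod_pos[of "{..<?p}" "prime_part n"] pos
      by (simp add: cofactor_def Suc_le_eq)
  next
    case 2
    have "cofactor d dvd d"
      using cofactor_mult[of d] by (metis dvd_triv_right)
    have "\<not> ?p dvd cofactor d"
      unfolding cofactor_def using d 2(1)
      by (intro multiplicity_decompose) (auto simp: prime_nat_iff)
    have "?p \<le> Suc n"
      using 2(2) assms dvd_trans dvd_imp_le by (metis le_SucI)
    then have "n = (\<Prod>j<?p. prime_part n j) * (\<Prod>j=?p..<Suc n. prime_part n j)"
      using prod_prime_part[OF assms(1)] prod.atLeastLessThan_concat[of 0 ?p "Suc n" "prime_part n"]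
      by (simp only: lessThan_atLeast0)
    \<comment> \<open>A prime \<open>j >= ?p\<close> dividing the cofactor would divide
      \<open>d\<close>, hence equal \<open>?p\<close>, but all factors \<open>?p\<close> have been
      removed.\<close>
    moreover have "coprime (cofactor d) (\<Prod>j=?p..<Suc n. prime_part n j)"
    proof (rule prod_coprime_right)
      fix j assume j: "j \<in> {?p..<Suc n}"
      have "\<not> j dvd cofactor d" if "prime j"
        using 2(3)[OF that] j \<open>cofactor d dvd d\<close> \<open>\<not> ?p dvd cofactor d\<close>
        by (metis atLeastLessThan_iff dvd_trans le_antisym)
      then show "coprime (cofactor d) (prime_part n j)"
        by (auto simp: prime_part_def coprime_commute prime_imp_coprime_nat)
    qed
    ultimately have "cofactor d dvd (\<Prod>j<?p. prime_part n j)"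
      using \<open>cofactor d dvd d\<close> assms(2) by (metis coprime_dvd_mult_left_iff dvd_trans)
    then show ?thesis
      using pos by (intro dvd_imp_le prod_pos) auto
  qed
qed

section \<open>Merging elements into blocks\<close>

locale eta_bounded_group = comm_group G for G (structure) +
  fixes r :: nat and c :: real
  assumes finite_carrier: "finite (carrier G)"
    and rank: "has_rank G r"
    and bound: "eta_linear_bound r c"
begin

lemma c_pos: "0 < c"
  using bound by (simp add: eta_linear_bound_def)

text \<open>
  If \<open>x\<close> is \<open>e\<close>-torsion, its \<open>i\<close>-th coordinate \<open>a\<close> in \<open>\<int>/n\<^sub>i\<close> satisfies \<open>n\<^sub>i dvd e * a\<close>,
  and \<open>a \<mapsto> e * a div n\<^sub>i\<close> modulo \<open>m\<close> defines a homomorphism from the \<open>e\<close>-torsion of \<open>G\<close>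
  to \<open>C_m^r\<close> with kernel the \<open>e div m\<close>-torsion.
\<close>

lemma torsion_hom_to_cyclic_power:
  assumes m: "0 < m" "m dvd e"
  obtains \<psi> where
    "\<And>x. x \<in> carrier G \<Longrightarrow> \<psi> x \<in> carrier (cyclic_power m r)"
    "\<psi> \<one> = \<one>\<^bsub>cyclic_power m r\<^esub>"
    "\<And>x y. \<lbrakk>x \<in> carrier G; y \<in> carrier G; x [^] e = \<one>; y [^] e = \<one>\<rbrakk>
      \<Longrightarrow> \<psi> (x \<otimes> y) = \<psi> x \<otimes>\<^bsub>cyclic_power m r\<^esub> \<psi> y"
    "\<And>x. \<lbrakk>x \<in> carrier G; x [^] e = \<one>; \<psi> x = \<one>\<^bsub>cyclic_power m r\<^esub>\<rbrakk> \<Longrightarrow> x [^] (e div m) = \<one>"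
proof -
  obtain ns where ns: "length ns = r" "\<And>i. i < r \<Longrightarrow> 1 < ns ! i"
    and "G \<cong> product_group {..<r} (\<lambda>i. integer_mod_group (ns ! i))" (is "_ \<cong> ?P")
    using rank by (auto simp: has_rank_def invariant_factors_def)
  then obtain h where "h \<in> iso G ?P"
    by (auto simp: is_iso_def)
  then have hom: "h \<in> hom G ?P" and inj: "inj_on h (carrier G)"
    by (auto simp: iso_def bij_betw_def)
  interpret P: comm_group ?P
    by (rule comm_group_product_integer_mod_group)
  interpret h: group_hom G ?P h
    using hom by unfold_locales
  have pow: "h (x [^] (t::nat)) i = (int t * h x i) mod int (ns ! i)"
    if "x \<in> carrier G" "i < r" for x t i
    using that pow_product_integer_mod_group[of "h x" "{..<r}" "\<lambda>i. ns ! i" i t] h.hom_closed[of x]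
    by (simp add: h.hom_nat_pow del: carrier_product_group)
  have dvd: "int (ns ! i) dvd int e * h x i" if "x \<in> carrier G" "x [^] e = \<one>" "i < r" for x i
    using that pow[of x i e] by (simp add: dvd_eq_mod_eq_0)
  define \<psi> where "\<psi> = (\<lambda>x. \<lambda>i\<in>{..<r}. (int e * h x i div int (ns ! i)) mod int m)"
  show ?thesis
  proof
    show "\<psi> x \<in> carrier (cyclic_power m r)" for x
      using m by (auto simp: \<psi>_def cyclic_power_def carrier_integer_mod_group)
    show "\<psi> \<one> = \<one>\<^bsub>cyclic_power m r\<^esub>"
      by (auto simp: \<psi>_def cyclic_power_def)
    show "\<psi> (x \<otimes> y) = \<psi> x \<otimes>\<^bsub>cyclic_power m r\<^esub> \<psi> y"
      if xy: "x \<in> carrier G" "y \<in> carrier G" "x [^] e = \<one>" "y [^] e = \<one>" for x y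
    proof -
      have "(int e * ((h x i + h y i) mod int (ns ! i)) div int (ns ! i)) mod int m =
          ((int e * h x i div int (ns ! i)) mod int m + (int e * h y i div int (ns ! i)) mod int m) mod int m"
        if "i < r" for i
        using xy that dvd m ns(2)[OF that] by (intro scaled_quotient_add_mod) auto
      then show ?thesis
        using xy by (auto simp: \<psi>_def cyclic_power_def restrict_def fun_eq_iff)
    qed
    show "x [^] (e div m) = \<one>"
      if x: "x \<in> carrier G" "x [^] e = \<one>" "\<psi> x = \<one>\<^bsub>cyclic_power m r\<^esub>" for x
    proof -
      have e: "int e = int m * int (e div m)"
        using m by (metis dvd_mult_div_cancel of_nat_mult)
      have "h (x [^] (e div m)) i = h \<one> i" for i
      proof (cases "i < r")
        case True
        have "\<psi> x i = 0"
          using x(3) True by (simp add: cyclic_power_def)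
        then have "(int e * h x i div int (ns ! i)) mod int m = 0"
          using True by (simp add: \<psi>_def)
        then have "int (ns ! i) dvd int (e div m) * h x i"
          using scaled_quotient_mod_eq_0[of "int (ns ! i)" "int m" "int (e div m)" "h x i"]
            dvd[OF x(1,2) True] ns(2)[OF True] m
          unfolding e[symmetric] by simp
        then show ?thesis
          using pow[OF x(1) True] True by simp
      next
        case False
        then have "i \<notin> {..<r}" by simp
        then show ?thesis
          using h.hom_closed[of "x [^] (e div m)"] h.hom_closed[OF one_closed] x(1)
          by (simp add: PiE_def extensional_def)
      qed
      then have "h (x [^] (e div m)) = h \<one>" ..
      then show ?thesis
        using inj x(1) by (meson inj_onD nat_pow_closed one_closed)
    qed
  qed
qed

text \<open>A short zero-sum subsequence of the images in \<open>C_m^r\<close> is lifted back to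
  \<open>M\<close>. The map \<open>f\<close> lets the entries of \<open>M\<close> be tagged blocks,
  with \<open>f\<close> giving their sums.\<close>

lemma merge:
  assumes m: "0 < m" "m dvd e"
    and f: "\<And>x. x \<in># M \<Longrightarrow> f x \<in> carrier G" "\<And>x. x \<in># M \<Longrightarrow> f x [^] e = \<one>"
    and size: "c * (real m - 1) < size M"
  shows "\<exists>N. N \<subseteq># M \<and> N \<noteq> {#} \<and> size N \<le> m \<and> seq_sum G (image_mset f N) [^] (e div m) = \<one>"
proof (rule torsion_hom_to_cyclic_power[OF m])
  let ?C = "cyclic_power m r"
  interpret C: comm_group ?C
    unfolding cyclic_power_def by (rule comm_group_product_integer_mod_group)
  fix \<psi> assume \<psi>: "\<And>x. x \<in> carrier G \<Longrightarrow> \<psi> x \<in> carrier ?C" "\<psi> \<one> = \<one>\<^bsub>?C\<^esub>"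
    "\<And>x y. \<lbrakk>x \<in> carrier G; y \<in> carrier G; x [^] e = \<one>; y [^] e = \<one>\<rbrakk>
      \<Longrightarrow> \<psi> (x \<otimes> y) = \<psi> x \<otimes>\<^bsub>?C\<^esub> \<psi> y"
    "\<And>x. \<lbrakk>x \<in> carrier G; x [^] e = \<one>; \<psi> x = \<one>\<^bsub>?C\<^esub>\<rbrakk> \<Longrightarrow> x [^] (e div m) = \<one>"
  have "seq_over ?C (image_mset (\<lambda>x. \<psi> (f x)) M)"
    using f \<psi>(1) by (auto simp: seq_over_def)
  then obtain T where T: "T \<subseteq># image_mset (\<lambda>x. \<psi> (f x)) M" "T \<noteq> {#}" "zero_sum ?C T" "size T \<le> m"
    using eta_linear_boundD[OF bound m(1)] size by fastforce
  then obtain N where N: "N \<subseteq># M" "image_mset (\<lambda>x. \<psi> (f x)) N = T"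
    by (elim subseteq_image_msetE)
  \<comment> \<open>The map is additive only on \<open>e\<close>-torsion, so the induction also
    carries that the partial sums are killed by \<open>e\<close>.\<close>
  have "seq_over G (image_mset f N) \<and> seq_over ?C (image_mset (\<lambda>x. \<psi> (f x)) N)
      \<and> seq_sum G (image_mset f N) [^] e = \<one>
      \<and> \<psi> (seq_sum G (image_mset f N)) = seq_sum ?C (image_mset (\<lambda>x. \<psi> (f x)) N)"
    using N(1)
  proof (induction N)
    case empty
    then show ?case using \<psi>(2) by simp
  next
    case (add x N)
    then have "x \<in># M" "N \<subseteq># M"
      by (auto dest: mset_subset_eq_insertD)
    with add.IH f[of x] \<psi>(1,3) show ?case
      by (simp add: pow_mult_distrib m_comm)
  qed
  then have "seq_sum G (image_mset f N) [^] (e div m) = \<one>"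
    using T(3) N(2) by (intro \<psi>(4)) (auto simp: zero_sum_def)
  then show ?thesis
    using N T by (intro exI[of _ N]) auto
qed

lemma merge_greedily:
  assumes m: "0 < m" "m dvd e"
    and f: "\<And>x. x \<in># M \<Longrightarrow> f x \<in> carrier G" "\<And>x. x \<in># M \<Longrightarrow> f x [^] e = \<one>"
  shows "\<exists>F. (\<forall>B\<in>#F. B \<noteq> {#} \<and> size B \<le> m \<and> seq_sum G (image_mset f B) [^] (e div m) = \<one>) \<and>
    \<Sum>\<^sub># F \<subseteq># M \<and> real (size M) \<le> size (\<Sum>\<^sub># F) + c * (real m - 1)"
proof (rule greedy_extraction)
  fix N assume "N \<subseteq># M" "c * (real m - 1) < size N"
  then show "\<exists>B. B \<subseteq># N \<and> B \<noteq> {#} \<and> size B \<le> m \<and> seq_sum G (image_mset f B) [^] (e div m) = \<one>"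
    using m f by (intro merge) (auto dest: mset_subset_eqD)
qed

text \<open>One number \<open>q\<close> controls both torsion and cross number, so a block of level
  \<open>q = 1\<close> is itself a tiny zero-sum sequence.\<close>

definition block :: "nat \<Rightarrow> 'a multiset \<Rightarrow> bool" where
  "block q B \<longleftrightarrow> B \<noteq> {#} \<and> seq_over G B \<and> seq_sum G B [^] q = \<one> \<and> cross_number G B \<le> 1 / real q"

text \<open>At most \<open>p\<close> pieces of cross number at most \<open>1 / (p * q)\<close> add
  up to at most \<open>1 / q\<close>; merging supplies the condition on the sum.\<close>

lemma block_Union:
  assumes p: "0 < p" and N: "N \<noteq> {#}" "size N \<le> p" "\<And>x. x \<in># N \<Longrightarrow> block (p * q) (g x)"
    and sum: "seq_sum G (image_mset (\<lambda>x. seq_sum G (g x)) N) [^] q = \<one>"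
  shows "block q (\<Sum>x\<in>#N. g x)"
proof -
  have over: "seq_over G (g x)" if "x \<in># N" for x
    using N(3)[OF that] by (simp add: block_def)
  have "cross_number G (\<Sum>x\<in>#N. g x) \<le> size N * (1 / real (p * q))"
    using N(3)
  proof (induction N)
    case empty
    then show ?case by (simp add: cross_number_def)
  next
    case (add x N)
    then have "cross_number G (g x) \<le> 1 / real (p * q)"
      by (simp add: block_def)
    with add show ?case
      by (simp add: cross_number_def distrib_right add_divide_distrib)
  qed
  also have "\<dots> \<le> p * (1 / real (p * q))"
    using N(2) by (intro mult_right_mono) auto
  also have "\<dots> = 1 / q"
    using p by simp
  finally have "cross_number G (\<Sum>x\<in>#N. g x) \<le> 1 / q" .
  moreover obtain x where "x \<in># N"
    using N(1) by blast
  then have "(\<Sum>x\<in>#N. g x) \<noteq> {#}"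
    using N(3) by (auto simp: block_def)
  ultimately show ?thesis
    using seq_sum_Union[of N g] over sum by (simp add: block_def)
qed

text \<open>
  Merging at most \<open>p\<close> blocks of level \<open>a + 1\<close> into one of level \<open>a\<close> does not lower the total
  weight \<open>p ^ - i\<close>, and at most \<open>c * (p - 1)\<close> blocks of level \<open>a + 1\<close> are wasted.
\<close>

lemma prime_power_blocks_imp_tiny:
  assumes p: "0 < p"
    and "\<And>x. x \<in># F \<Longrightarrow> fst x \<le> a \<and> block (p ^ fst x) (snd x)"
    and "c * (real p ^ a - 1) < (\<Sum>x\<in>#F. real p ^ (a - fst x))"
  shows "\<exists>T. tiny_zero_sum_subseq G (\<Sum>x\<in>#F. snd x) T"
  using assms(2,3)
proof (induction a arbitrary: F)
  case 0
  \<comment> \<open>The threshold is \<open>c * (p ^ 0 - 1) = 0\<close>, so the sum of weights is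
    positive and some block of level 1 exists.\<close>
  then have "F \<noteq> {#}" by auto
  then obtain x where x: "x \<in># F" by blast
  have "block 1 (snd x)"
    using 0(1)[OF x] by auto
  moreover have "snd x \<subseteq># (\<Sum>x\<in>#F. snd x)"
    using x by (auto dest!: multi_member_split)
  ultimately show ?case
    by (auto simp: block_def tiny_zero_sum_subseq_def zero_sum_def)
next
  case (Suc a)
  \<comment> \<open>Only the blocks in \<open>U\<close>, of top level \<open>Suc a\<close>, are
    merged; those in \<open>L\<close> are kept.\<close>
  define L where "L = filter_mset (\<lambda>x. fst x \<le> a) F"
  define U where "U = filter_mset (\<lambda>x. \<not> fst x \<le> a) F"
  have F: "F = L + U"
    unfolding L_def U_def by (rule multiset_partition)
  have L: "fst x \<le> a" "block (p ^ fst x) (snd x)" if "x \<in># L" for x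
    using that Suc.prems(1) by (auto simp: L_def)
  have U: "fst x = Suc a" "block (p * p ^ a) (snd x)" if "x \<in># U" for x
  proof -
    show "fst x = Suc a"
      using that Suc.prems(1)[of x] by (simp add: U_def)
    then show "block (p * p ^ a) (snd x)"
      using that Suc.prems(1)[of x] by (simp add: U_def)
  qed
  have "p dvd p * p ^ a" by simp
  moreover have "seq_sum G (snd x) \<in> carrier G" "seq_sum G (snd x) [^] (p * p ^ a) = \<one>"
    if "x \<in># U" for x
    using U(2)[OF that] by (simp_all add: block_def)
  ultimately obtain E where E: "\<forall>N\<in>#E. N \<noteq> {#} \<and> size N \<le> p \<and>
        seq_sum G (image_mset (\<lambda>x. seq_sum G (snd x)) N) [^] (p * p ^ a div p) = \<one>"
      "\<Sum>\<^sub># E \<subseteq># U" "real (size U) \<le> size (\<Sum>\<^sub># E) + c * (real p - 1)"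
    using merge_greedily[OF p, of "p * p ^ a" U "\<lambda>x. seq_sum G (snd x)"] by blast
  define F' where "F' = L + image_mset (\<lambda>N. (a, \<Sum>x\<in>#N. snd x)) E"
  have F': "fst x \<le> a \<and> block (p ^ fst x) (snd x)" if "x \<in># F'" for x
  proof -
    have "block (p ^ a) (\<Sum>x\<in>#N. snd x)" if "N \<in># E" for N
    proof (rule block_Union[OF p])
      show "block (p * p ^ a) (snd x)" if "x \<in># N" for x
        using U(2)[of x] E(2) \<open>N \<in># E\<close> that by (auto dest!: mset_subset_eqD simp: in_Union_mset_iff)
    qed (use E(1) that p in auto)
    then show ?thesis
      using that L[of x] by (auto simp: F'_def)
  qed
  have "c * (real p ^ a - 1) < (\<Sum>x\<in>#F'. real p ^ (a - fst x))"
  proof -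
    have "(\<Sum>x\<in>#L. real p ^ (Suc a - fst x)) = p * (\<Sum>x\<in>#L. real p ^ (a - fst x))"
    proof -
      have "image_mset (\<lambda>x. real p ^ (Suc a - fst x)) L = image_mset (\<lambda>x. p * real p ^ (a - fst x)) L"
        by (intro image_mset_cong) (simp add: L(1) Suc_diff_le)
      then show ?thesis by (simp only: sum_mset_distrib_left)
    qed
    moreover have "(\<Sum>x\<in>#U. real p ^ (Suc a - fst x)) = size U"
    proof -
      have "image_mset (\<lambda>x. real p ^ (Suc a - fst x)) U = image_mset (\<lambda>x. 1) U"
        by (intro image_mset_cong) (simp add: U(1))
      then show ?thesis by simp
    qed
    moreover have "size (\<Sum>\<^sub># E) \<le> size E * p"
      using E(1) sum_mset_mono[of E size "\<lambda>_. p"] by simp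
    then have "real (size (\<Sum>\<^sub># E)) \<le> size E * p"
      by (metis of_nat_le_iff of_nat_mult)
    \<comment> \<open>Passing to level \<open>a\<close> multiplies the weights of \<open>L\<close>
      by \<open>1 / p\<close>, and the loss \<open>c * (p - 1)\<close> fits because
      \<open>c * (p ^ Suc a - 1) - c * (p - 1) = p * (c * (p ^ a - 1))\<close>.\<close>
    ultimately have "p * (c * (real p ^ a - 1)) < p * ((\<Sum>x\<in>#L. real p ^ (a - fst x)) + size E)"
      using Suc.prems(2) E(3) unfolding F by (simp add: algebra_simps del: size_mset_sum_mset_conv)
    then show ?thesis
      using p by (simp add: F'_def image_mset.compositionality o_def)
  qed
  from Suc.IH[OF F' this] obtain T where T: "tiny_zero_sum_subseq G (\<Sum>x\<in>#F'. snd x) T"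
    by blast
  have "(\<Sum>N\<in>#E. \<Sum>x\<in>#N. snd x) = (\<Sum>x\<in>#\<Sum>\<^sub># E. snd x)"
    by (induction E) auto
  also have "\<dots> \<subseteq># (\<Sum>x\<in>#U. snd x)"
    using E(2) by (auto simp: subset_mset.le_iff_add)
  finally have "(\<Sum>x\<in>#F'. snd x) \<subseteq># (\<Sum>x\<in>#F. snd x)"
    by (simp add: F'_def F image_mset.compositionality o_def)
  with T show ?case
    unfolding tiny_zero_sum_subseq_def by (meson subset_mset.order_trans)
qed

section \<open>Counting blocks over the divisors of the exponent\<close>

lemma exists_tiny_zero_sum_subseq:
  assumes S: "seq_over G S"
    and size: "c * (\<Sum>d | d dvd group_exponent G. real (cofactor d) - 1) + c * (real (group_exponent G) - 1) < size S"
  shows "\<exists>T. tiny_zero_sum_subseq G S T"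
proof -
  define n where "n = group_exponent G"
  define P where "P = largest_prime_divisor"
  define \<nu> where "\<nu> d = multiplicity (P d) d" for d
  define u where "u k = (\<Prod>j<k. prime_part n j)" for k
  define D where "D = {d. d dvd n}"
  define M where "M d = filter_mset (\<lambda>g. ord g = d) S" for d
  have n: "0 < n" "\<And>x. x \<in> carrier G \<Longrightarrow> x [^] n = \<one>"
    using group_exponent_finite[OF finite_carrier] by (simp_all add: n_def)
  have D: "0 < d" "d \<le> n" if "d \<in> D" for d
    using n that by (auto simp: D_def dvd_imp_le intro: Nat.gr0I)
  have finD: "finite D"
    using n by (simp add: D_def)
  have d_eq: "d = P d ^ \<nu> d * cofactor d" for d
    unfolding P_def \<nu>_def by (rule cofactor_mult)
  have cof_pos: "0 < cofactor d" "0 < P d ^ \<nu> d" if "d \<in> D" for d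
    using D(1)[OF that] d_eq[of d] by (metis mult_eq_0_iff neq0_conv)+
  have S_eq: "S = (\<Sum>d\<in>D. M d)"
    unfolding M_def
  proof (rule mset_eq_sum_filter[OF finD])
    show "ord x \<in> D" if "x \<in># S" for x
      using that S n(2)[of x] by (auto simp: D_def seq_over_def pow_eq_id)
  qed
  have "\<exists>F. (\<forall>B\<in>#F. B \<noteq> {#} \<and> size B \<le> cofactor d \<and> seq_sum G B [^] (P d ^ \<nu> d) = \<one>) \<and>
      \<Sum>\<^sub># F \<subseteq># M d \<and> real (size (M d)) \<le> size (\<Sum>\<^sub># F) + c * (real (cofactor d) - 1)"
    if d: "d \<in> D" for d
  proof -
    have "d div cofactor d = P d ^ \<nu> d"
      using d_eq[of d] cof_pos(1)[OF d] by (metis nonzero_mult_div_cancel_right neq0_conv)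
    moreover have "cofactor d dvd d"
      using d_eq[of d] by (metis dvd_triv_right)
    moreover have "x \<in> carrier G" "x [^] d = \<one>" if "x \<in># M d" for x
      using that S by (auto simp: M_def seq_over_def)
    ultimately show ?thesis
      using merge_greedily[OF cof_pos(1)[OF d], of d "M d" "\<lambda>x. x"] by simp
  qed
  then obtain F where F: "\<And>d B. d \<in> D \<Longrightarrow> B \<in># F d \<Longrightarrow>
        B \<noteq> {#} \<and> size B \<le> cofactor d \<and> seq_sum G B [^] (P d ^ \<nu> d) = \<one>"
      "\<And>d. d \<in> D \<Longrightarrow> \<Sum>\<^sub># (F d) \<subseteq># M d"
      "\<And>d. d \<in> D \<Longrightarrow> real (size (M d)) \<le> size (\<Sum>\<^sub># (F d)) + c * (real (cofactor d) - 1)"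
    by metis
  have block: "block (P d ^ \<nu> d) B" if d: "d \<in> D" and B: "B \<in># F d" for d B
  proof -
    have "B \<subseteq># M d"
      using F(2)[OF d] B by (auto dest!: multi_member_split intro: subset_mset.order_trans[OF mset_subset_eq_add_left])
    then have over: "seq_over G B" and ord: "\<And>g. g \<in># B \<Longrightarrow> ord g = d"
      using S by (auto simp: M_def seq_over_def dest!: mset_subset_eqD)
    have "image_mset (\<lambda>g. 1 / real (ord g)) B = image_mset (\<lambda>g. 1 / real d) B"
      using ord by (intro image_mset_cong) simp
    then have "cross_number G B = size B / real d"
      by (simp add: cross_number_def)
    also have "\<dots> \<le> cofactor d / real d"
      using F(1)[OF d B] by (intro divide_right_mono) auto
    also have "\<dots> = 1 / real (P d ^ \<nu> d)"
      using d_eq[of d] cof_pos[OF d] by (metis divide_self_if mult.right_neutral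
        nonzero_divide_mult_cancel_right of_nat_0_less_iff of_nat_mult order_less_irrefl)
    finally show ?thesis
      using F(1)[OF d B] over by (simp add: block_def)
  qed
  \<comment> \<open>Otherwise, weighting the blocks for \<open>k\<close> by \<open>u k\<close>, a
    bound on their lengths, leaves at most \<open>c * (n - 1)\<close> entries of \<open>S\<close> in
    blocks. For \<open>k = 1\<close> the threshold is 0.\<close>
  have "\<exists>k<Suc n. c * (real (prime_part n k) - 1) < (\<Sum>d | d \<in> D \<and> P d = k. real (size (F d)))"
  proof (rule ccontr)
    assume "\<not> ?thesis"
    then have less: "(\<Sum>d | d \<in> D \<and> P d = k. real (size (F d))) \<le> c * (real (prime_part n k) - 1)"
      if "k < Suc n" for k
      using that by (meson not_le)
    have "real (size (\<Sum>\<^sub># (F d))) \<le> real (u (P d)) * size (F d)" if d: "d \<in> D" for d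
    proof -
      have "size (\<Sum>\<^sub># (F d)) \<le> cofactor d * size (F d)"
        using F(1)[OF d] sum_mset_mono[of "F d" size "\<lambda>_. cofactor d"] by (simp add: mult.commute)
      also have "\<dots> \<le> u (P d) * size (F d)"
        using cofactor_le[OF n(1), of d] d by (auto simp: u_def P_def D_def)
      finally show ?thesis
        by (metis of_nat_le_iff of_nat_mult)
    qed
    then have "(\<Sum>d\<in>D. real (size (\<Sum>\<^sub># (F d)))) \<le> (\<Sum>d\<in>D. real (u (P d)) * size (F d))"
      by (rule sum_mono)
    also have "\<dots> = (\<Sum>k<Suc n. \<Sum>d | d \<in> D \<and> P d = k. real (u (P d)) * size (F d))"
    proof (rule sum.group[symmetric])
      have "P d \<le> n" if "d \<in> D" for d
        using D(1)[OF that]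
        by (cases rule: largest_prime_divisor_cases)
          (use D[OF that] n in \<open>auto simp: P_def dest!: dvd_imp_le\<close>)
      then show "P ` D \<subseteq> {..<Suc n}" by (auto simp: less_Suc_eq_le)
    qed (use finD in auto)
    also have "\<dots> = (\<Sum>k<Suc n. real (u k) * (\<Sum>d | d \<in> D \<and> P d = k. real (size (F d))))"
      by (intro sum.cong refl) (auto simp: sum_distrib_left)
    also have "\<dots> \<le> (\<Sum>k<Suc n. real (u k) * (c * (real (prime_part n k) - 1)))"
      using less by (intro sum_mono mult_left_mono) auto
    also have "\<dots> = c * (\<Sum>k<Suc n. (\<Prod>j<k. real (prime_part n j)) * (real (prime_part n k) - 1))"
      unfolding sum_distrib_left by (intro sum.cong) (auto simp: u_def algebra_simps)
    also have "\<dots> = c * (real n - 1)"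
      using prod_prime_part[OF n(1)] unfolding sum_prod_telescope by (metis of_nat_prod)
    finally have "(\<Sum>d\<in>D. real (size (\<Sum>\<^sub># (F d)))) \<le> c * (real n - 1)" .
    moreover have "real (size S) = (\<Sum>d\<in>D. real (size (M d)))"
      by (subst S_eq) (simp del: of_nat_sum add: of_nat_sum[symmetric])
    moreover have "(\<Sum>d\<in>D. real (size (M d))) \<le>
        (\<Sum>d\<in>D. real (size (\<Sum>\<^sub># (F d))) + c * (real (cofactor d) - 1))"
      using F(3) by (rule sum_mono)
    ultimately show False
      using size by (simp add: sum.distrib sum_distrib_left D_def n_def del: size_mset_sum_mset_conv)
  qed
  then obtain k where k: "c * (real (prime_part n k) - 1) < (\<Sum>d | d \<in> D \<and> P d = k. real (size (F d)))"
    by blast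
  define D' where "D' = {d \<in> D. P d = k}"
  have pp: "1 \<le> prime_part n k"
    by (auto simp: prime_part_def prime_gt_0_nat Suc_le_eq)
  then have "0 \<le> c * (real (prime_part n k) - 1)"
    using c_pos by simp
  \<comment> \<open>A nonnegative threshold is not exceeded by an empty sum, so \<open>k\<close> is
    \<open>P d\<close> for some \<open>d\<close>, that is, 1 or a prime.\<close>
  with k have "D' \<noteq> {}"
    unfolding D'_def by (metis less_le_not_le order_le_less_trans sum.empty)
  then obtain d where d: "d \<in> D" "P d = k" by (auto simp: D'_def)
  have kpos: "0 < k" and part: "prime_part n k = k ^ multiplicity k n"
    using D(1)[OF d(1)] d(2)
    by (cases rule: largest_prime_divisor_cases; force simp: P_def prime_part_def prime_gt_0_nat)+
  \<comment> \<open>Each block is tagged with the exponent \<open>\<nu> d\<close> of its level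
    \<open>k ^ \<nu> d\<close>.\<close>
  define E where "E = (\<Sum>d\<in>D'. image_mset (Pair (\<nu> d)) (F d))"
  have E_mem: "\<exists>d\<in>D'. \<exists>B\<in>#F d. x = (\<nu> d, B)" if "x \<in># E" for x
    using that finD by (auto simp: E_def D'_def set_mset_sum)
  have "\<exists>T. tiny_zero_sum_subseq G (\<Sum>x\<in>#E. snd x) T"
  proof (rule prime_power_blocks_imp_tiny[OF kpos])
    show "fst x \<le> multiplicity k n \<and> block (k ^ fst x) (snd x)" if x: "x \<in># E" for x
    proof -
      obtain d B where "d \<in> D" "P d = k" "B \<in># F d" "x = (\<nu> d, B)"
        using E_mem[OF x] by (auto simp: D'_def)
      then show ?thesis
        using block[of d B] n(1) by (auto simp: \<nu>_def D_def intro: dvd_imp_multiplicity_le)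
    qed
    have "c * (real k ^ multiplicity k n - 1) < size E"
      using k part by (simp add: E_def D'_def)
    also have "real (size E) = (\<Sum>x\<in>#E. 1)"
      by simp
    \<comment> \<open>Each weight is at least 1, so the number of blocks bounds the total weight
      from below.\<close>
    also have "\<dots> \<le> (\<Sum>x\<in>#E. real k ^ (multiplicity k n - fst x))"
      using kpos by (intro sum_mset_mono) (simp add: Suc_le_eq)
    finally show "c * (real k ^ multiplicity k n - 1) < (\<Sum>x\<in>#E. real k ^ (multiplicity k n - fst x))" .
  qed
  moreover have "(\<Sum>x\<in>#E. snd x) \<subseteq># S"
  proof -
    have "(\<Sum>x\<in>#E. snd x) = (\<Sum>d\<in>D'. \<Sum>\<^sub># (F d))"
      unfolding E_def
      by (induction D' rule: infinite_finite_induct) (auto simp: image_mset.compositionality o_def)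
    also have "\<dots> \<subseteq># (\<Sum>d\<in>D'. M d)"
      using F(2) by (intro sum_subseteq_mset_mono) (auto simp: D'_def)
    also have "\<dots> \<subseteq># (\<Sum>d\<in>D'. M d) + (\<Sum>d\<in>D - D'. M d)"
      by simp
    also have "\<dots> = S"
      using finD S_eq by (metis (no_types, lifting) D'_def add.commute mem_Collect_eq subsetI sum.subset_diff)
    finally show ?thesis .
  qed
  ultimately show ?thesis
    unfolding tiny_zero_sum_subseq_def by (meson subset_mset.order_trans)
qed

end

section \<open>The bound for the tiny zero-sum constant\<close>

theorem theorem3:
  fixes G :: "('a, 'b) monoid_scheme" and r n :: nat and c\<^sub>r :: real
  assumes "r \<ge> 1"
    and "comm_group G" and "finite (carrier G)"
    and "has_rank G r" and "group_exponent G = n"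
    and "is_eta_slope r c\<^sub>r"
  shows "real (tiny_const G) \<le>
    c\<^sub>r * (\<Sum>d | d dvd n.
        real d / real (largest_prime_divisor d ^ multiplicity (largest_prime_divisor d) d) - 1)
    + c\<^sub>r * (real n - 1) + 1"
proof -
  interpret comm_group G by fact
  interpret eta_bounded_group G r c\<^sub>r
    using assms by unfold_locales (auto simp: is_eta_slope_def)
  have n: "0 < n"
    using group_exponent_finite(1) assms by blast
  have quot: "real d / real (largest_prime_divisor d ^ multiplicity (largest_prime_divisor d) d) = cofactor d" for d
    unfolding cofactor_def by (simp add: real_of_nat_div multiplicity_dvd)
  define b where "b = c\<^sub>r * (\<Sum>d | d dvd n. real (cofactor d) - 1) + c\<^sub>r * (real n - 1)"
  have "1 \<le> cofactor d" if "d dvd n" for d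
    using cofactor_mult[of d] that n by (cases "cofactor d") auto
  then have "0 \<le> (\<Sum>d | d dvd n. real (cofactor d) - 1)"
    by (intro sum_nonneg) auto
  then have "0 \<le> b"
    using c_pos n by (simp add: b_def)
  \<comment> \<open>\<open>Suc (nat \<lfloor>b\<rfloor>)\<close> is the least positive integer above
    \<open>b\<close>; by \<open>0 \<le> b\<close> it is at most \<open>b + 1\<close>.\<close>
  have "tiny_const G \<le> Suc (nat \<lfloor>b\<rfloor>)"
    unfolding tiny_const_def
  proof (intro Least_le conjI allI impI)
    fix S assume S: "seq_over G S \<and> Suc (nat \<lfloor>b\<rfloor>) \<le> size S"
    then have "b < size S"
      by linarith
    then show "\<exists>T. tiny_zero_sum_subseq G S T"
      using S assms(5) by (intro exists_tiny_zero_sum_subseq) (auto simp: b_def)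
  qed simp
  also have "real (Suc (nat \<lfloor>b\<rfloor>)) \<le> b + 1"
    using \<open>0 \<le> b\<close> by linarith
  finally show ?thesis
    unfolding quot b_def by simp
qed

end
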